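(* Let $\mathfrak{R}_{20}(0)$ be the $4$-dimensional complex Leibniz algebra with basis $e_1,\dots,e_4$ and nonzero brackets $[e_1,e_2]=e_4$, $[e_2,e_1]=e_4$, $[e_2,e_2]=e_3$, and let $\mu_1$ be the $2$-dimensional Leibniz algebra with basis $e_1,e_2$ and only nonzero bracket $[e_1,e_1]=e_2$. Then $\mathfrak{R}_{20}(0)$ has one metric deformation, to $\mu_1\oplus\mu_1$.
   Context: All algebras are over $\mathbb{C}$. A left (resp. right) Leibniz algebra is a vector space $\mathfrak{L}$ with a bilinear bracket satisfying $[x,[y,z]]=[[x,y],z]+[y,[x,z]]$ (resp. $[x,[y,z]]=[[x,y],z]-[[x,z],y]$); a Leibniz algebra is one or the other. A bilinear form $B$ on $\mathfrak{L}$ is invariant if $B([x,y],z)=B(x,[y,z])$ for all $x,y,z$. $\mathfrak{L}$ is metric if it has a non-degenerate symmetric invariant bilinear form. A (formal $1$-parameter, Leibniz) deformation of $(\mathfrak{L},\mu_0)$ is a Leibniz bracket $\mu_t=\mu_0+t\phi_1+t^2\phi_2+\cdots$ on $\mathfrak{L}\otimes\mathbb{C}[[t]]$, with $\phi_i$ bilinear maps $\mathfrak{L}\times\mathfrak{L}\to\mathfrak{L}$. Two deformations $\mu_t,\tilde\mu_t$ are equivalent if $\tilde\mu_t(x,y)=\Phi_t\mu_t(\Phi_t^{-1}x,\Phi_t^{-1}y)$ for some $\Phi_t=\mathrm{id}+t\,\Phi_1+t^2\Phi_2+\cdots$ with linear $\Phi_i$; a deformation equivalent to $\mu_0$ is trivial.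 A metric deformation is a non-trivial deformation $\mu_t$ that is a metric Leibniz algebra for $t\neq 0$ (for formal $t$: after extending scalars to $\mathbb{C}((t))$). A deformation is to a Leibniz algebra $\mathfrak{N}$ if $(\mathfrak{L},\mu_t)\cong\mathfrak{N}$ for all nonzero $t$ near $0$ (with $\mu_t$ polynomial in $t$). Metric deformations are counted by the isomorphism type of the deformed algebra. *)

theory Defs
  imports "HOL-Analysis.Analysis" "HOL-Algebra.Algebraic_Closure_Type"
begin

text \<open>
  A finite-dimensional algebra over a commutative ring \<open>'k\<close> is a bracket on the free module
  \<open>'k ^ 'n\<close>, whose standard basis is given by the vectors \<open>axis i 1\<close>.
\<close>

type_synonym ('k, 'n) bracket = "'k ^ 'n \<Rightarrow> 'k ^ 'n \<Rightarrow> 'k ^ 'n"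

definition bilinear_bracket :: "('k::comm_ring_1, 'n::finite) bracket \<Rightarrow> bool" where
  "bilinear_bracket m \<longleftrightarrow>
     (\<forall>x. module_hom (*s) (*s) (\<lambda>y. m x y)) \<and> (\<forall>y. module_hom (*s) (*s) (\<lambda>x. m x y))"

definition left_leibniz :: "('k::comm_ring_1, 'n::finite) bracket \<Rightarrow> bool" where
  "left_leibniz m \<longleftrightarrow> (\<forall>x y z. m x (m y z) = m (m x y) z + m y (m x z))"

definition right_leibniz :: "('k::comm_ring_1, 'n::finite) bracket \<Rightarrow> bool" where
  "right_leibniz m \<longleftrightarrow> (\<forall>x y z. m x (m y z) = m (m x y) z - m (m x z) y)"

definition leibniz_bracket :: "('k::comm_ring_1, 'n::finite) bracket \<Rightarrow> bool" where
  "leibniz_bracket m \<longleftrightarrow> bilinear_bracket m \<and> (left_leibniz m \<or> right_leibniz m)"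

definition bilinear_form :: "('k::field ^ 'n::finite \<Rightarrow> 'k ^ 'n \<Rightarrow> 'k) \<Rightarrow> bool" where
  "bilinear_form B \<longleftrightarrow>
     (\<forall>x. Vector_Spaces.linear (*s) (*) (\<lambda>y. B x y)) \<and>
     (\<forall>y. Vector_Spaces.linear (*s) (*) (\<lambda>x. B x y))"

definition metric_leibniz :: "('k::field, 'n::finite) bracket \<Rightarrow> bool" where
  "metric_leibniz m \<longleftrightarrow> leibniz_bracket m \<and>
     (\<exists>B. bilinear_form B \<and>
          (\<forall>x y. B x y = B y x) \<and>
          (\<forall>x y z. B (m x y) z = B x (m y z)) \<and>
          (\<forall>x. (\<forall>y. B x y = 0) \<longrightarrow> x = 0))"

definition alg_isomorphic ::
  "('k::field, 'n::finite) bracket \<Rightarrow> ('k, 'm::finite) bracket \<Rightarrow> bool" where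
  "alg_isomorphic m m' \<longleftrightarrow>
     (\<exists>f. Vector_Spaces.linear (*s) (*s) f \<and> bij f \<and> (\<forall>x y. f (m x y) = m' (f x) (f y)))"

definition direct_sum ::
  "('k::comm_ring_1, 'n::finite) bracket \<Rightarrow> ('k, 'm::finite) bracket \<Rightarrow> ('k, 'n + 'm) bracket" where
  "direct_sum m m' x y =
     (\<chi> k. case k of
        Inl i \<Rightarrow> vec_nth (m (\<chi> j. vec_nth x (Inl j)) (\<chi> j. vec_nth y (Inl j))) i
      | Inr i \<Rightarrow> vec_nth (m' (\<chi> j. vec_nth x (Inr j)) (\<chi> j. vec_nth y (Inr j))) i)"

text \<open>\<open>c i j k\<close> is the coefficient of the \<open>k\<close>-th basis vector in the bracket of the
  \<open>i\<close>-th and \<open>j\<close>-th ones.\<close>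

definition bracket_of :: "('n \<Rightarrow> 'n \<Rightarrow> 'n \<Rightarrow> 'k) \<Rightarrow> ('k::comm_ring_1, 'n::finite) bracket" where
  "bracket_of c x y = (\<chi> k. \<Sum>i\<in>UNIV. \<Sum>j\<in>UNIV. c i j k * vec_nth x i * vec_nth y j)"

definition structure_const ::
  "('k::comm_ring_1, 'n::finite) bracket \<Rightarrow> 'n \<Rightarrow> 'n \<Rightarrow> 'n \<Rightarrow> 'k" where
  "structure_const m i j k = vec_nth (m (axis i 1) (axis j 1)) k"

text \<open>Extension of scalars along a ring homomorphism \<open>h\<close>.\<close>

definition base_change ::
  "('k \<Rightarrow> 'l) \<Rightarrow> ('k::comm_ring_1, 'n::finite) bracket \<Rightarrow> ('l::comm_ring_1, 'n) bracket" where
  "base_change h m = bracket_of (\<lambda>i j k. h (structure_const m i j k))"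


text \<open>
  A deformation is encoded by its coefficients \<open>\<phi> 0 = \<mu>\<^sub>0, \<phi> 1, \<phi> 2, \<dots>\<close>;
  \<open>formal_bracket \<phi>\<close> is the \<open>\<complex>[[t]]\<close>-bilinear bracket \<open>\<Sum>\<^sub>n t\<^sup>n \<phi> n\<close> on
  \<open>\<complex>\<^sup>n \<otimes> \<complex>[[t]] = \<complex>[[t]]\<^sup>n\<close>, and \<open>formal_map \<Phi>\<close> is likewise \<open>\<Sum>\<^sub>n t\<^sup>n \<Phi> n\<close>.
\<close>

definition formal_bracket ::
  "(nat \<Rightarrow> (complex, 'n::finite) bracket) \<Rightarrow> (complex fps, 'n) bracket" where
  "formal_bracket \<phi> = bracket_of (\<lambda>i j k. Abs_fps (\<lambda>n. structure_const (\<phi> n) i j k))"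

definition formal_map ::
  "(nat \<Rightarrow> complex ^ 'n \<Rightarrow> complex ^ 'n) \<Rightarrow> complex fps ^ 'n::finite \<Rightarrow> complex fps ^ 'n" where
  "formal_map \<Phi> x =
     (\<chi> k. \<Sum>i\<in>UNIV. Abs_fps (\<lambda>n. vec_nth (\<Phi> n (axis i 1)) k) * vec_nth x i)"

definition deformation ::
  "(complex, 'n::finite) bracket \<Rightarrow> (nat \<Rightarrow> (complex, 'n) bracket) \<Rightarrow> bool" where
  "deformation m0 \<phi> \<longleftrightarrow>
     \<phi> 0 = m0 \<and> (\<forall>n. bilinear_bracket (\<phi> n)) \<and> leibniz_bracket (formal_bracket \<phi>)"

definition equivalent_deformations ::
  "(nat \<Rightarrow> (complex, 'n::finite) bracket) \<Rightarrow> (nat \<Rightarrow> (complex, 'n) bracket) \<Rightarrow> bool" where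
  "equivalent_deformations \<phi> \<psi> \<longleftrightarrow>
     (\<exists>\<Phi>. \<Phi> 0 = id \<and> (\<forall>n. Vector_Spaces.linear (*s) (*s) (\<Phi> n)) \<and>
        (\<forall>x y. formal_bracket \<psi> x y =
           formal_map \<Phi> (formal_bracket \<phi> (inv_into UNIV (formal_map \<Phi>) x)
                                       (inv_into UNIV (formal_map \<Phi>) y))))"

definition constant_deformation ::
  "(complex, 'n::finite) bracket \<Rightarrow> nat \<Rightarrow> (complex, 'n) bracket" where
  "constant_deformation m0 n = (if n = 0 then m0 else (\<lambda>x y. 0))"

definition trivial_deformation ::
  "(complex, 'n::finite) bracket \<Rightarrow> (nat \<Rightarrow> (complex, 'n) bracket) \<Rightarrow> bool" where
  "trivial_deformation m0 \<phi> \<longleftrightarrow> equivalent_deformations (constant_deformation m0) \<phi>"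

definition generic_bracket ::
  "(nat \<Rightarrow> (complex, 'n::finite) bracket) \<Rightarrow> (complex fls, 'n) bracket" where
  "generic_bracket \<phi> = base_change fps_to_fls (formal_bracket \<phi>)"

definition metric_deformation ::
  "(complex, 'n::finite) bracket \<Rightarrow> (nat \<Rightarrow> (complex, 'n) bracket) \<Rightarrow> bool" where
  "metric_deformation m0 \<phi> \<longleftrightarrow>
     deformation m0 \<phi> \<and> \<not> trivial_deformation m0 \<phi> \<and> metric_leibniz (generic_bracket \<phi>)"

definition polynomial_deformation :: "(nat \<Rightarrow> (complex, 'n::finite) bracket) \<Rightarrow> bool" where
  "polynomial_deformation \<phi> \<longleftrightarrow> finite {n. \<phi> n \<noteq> (\<lambda>x y. 0)}"

definition specialize ::
  "(nat \<Rightarrow> (complex, 'n::finite) bracket) \<Rightarrow> complex \<Rightarrow> (complex, 'n) bracket" where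
  "specialize \<phi> t x y = (\<Sum>n | \<phi> n \<noteq> (\<lambda>x y. 0). t ^ n *s \<phi> n x y)"

definition deforms_to ::
  "(nat \<Rightarrow> (complex, 'n::finite) bracket) \<Rightarrow> (complex, 'm::finite) bracket \<Rightarrow> bool" where
  "deforms_to \<phi> m \<longleftrightarrow>
     polynomial_deformation \<phi> \<and> (\<forall>\<^sub>F t in at 0. alg_isomorphic (specialize \<phi> t) m)"

text \<open>
  The isomorphism type of a formally deformed algebra is taken over the algebraic closure of
  \<open>\<complex>((t))\<close>. Over \<open>\<complex>((t))\<close> itself it would be finer than the isomorphism type of the complex
  algebras obtained by specializing \<open>t\<close>: rescaling basis vectors by \<open>\<surd>t\<close> is possible for each
  nonzero complex \<open>t\<close>, but not over \<open>\<complex>((t))\<close>.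
\<close>

definition formally_deforms_to ::
  "(nat \<Rightarrow> (complex, 'n::finite) bracket) \<Rightarrow> (complex, 'm::finite) bracket \<Rightarrow> bool" where
  "formally_deforms_to \<phi> m \<longleftrightarrow>
     alg_isomorphic (base_change to_ac (generic_bracket \<phi>))
       (base_change (\<lambda>c. to_ac (fls_const c)) m)"


text \<open>In the index type \<open>4\<close> the numeral \<open>4\<close> equals \<open>0\<close>, so \<open>1, 2, 3, 4\<close> are its four
  elements; similarly for the index type \<open>2\<close>.\<close>

definition R20_0 :: "(complex, 4) bracket" where
  "R20_0 = bracket_of (\<lambda>i j k. if (i, j, k) \<in> {(1, 2, 4), (2, 1, 4), (2, 2, 3)} then 1 else 0)"

definition mu1 :: "(complex, 2) bracket" where
  "mu1 = bracket_of (\<lambda>i j k. if (i, j, k) = (1, 1, 2) then 1 else 0)"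

end

theory Submission
  imports Defs
begin

text \<open>
  In a metric Leibniz algebra squares are central and, by invariance of the form, orthogonal to all
  products. For a deformation of \<open>R\<^sub>2\<^sub>0(0)\<close> the vectors \<open>e\<^sub>1, e\<^sub>2, e\<^sub>2\<^sup>2, e\<^sub>1e\<^sub>2 + e\<^sub>2e\<^sub>1\<close> are a basis, because
  they are one at \<open>t = 0\<close>, and this forces the deformed algebra to be commutative and 2-step
  nilpotent. It is therefore given by the pencil of binary quadratic forms \<open>(x e\<^sub>1 + y e\<^sub>2)\<^sup>2\<close>, which a
  change of basis over \<open>\<complex>[[t]]\<close>, congruent to the identity modulo \<open>t\<close>, brings to the form
  \<open>(D x\<^sup>2 + y\<^sup>2) e\<^sub>3 + 2 x y e\<^sub>4\<close>. If \<open>D = 0\<close> the deformation is trivial; otherwise the vectors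
  \<open>e\<^sub>1 \<plusminus> \<surd>D e\<^sub>2\<close> split the algebra as \<open>\<mu>\<^sub>1 \<oplus> \<mu>\<^sub>1\<close>. Up to a square, \<open>4 D\<close> is polynomial in the structure
  constants, so its nonvanishing carries over to the algebraic closure of \<open>\<complex>((t))\<close> and to all small
  nonzero values of \<open>t\<close>.
\<close>

no_notation fps_nth (infixl "$" 75)

section \<open>Brackets and structure constants\<close>

lemma module_vec: "Modules.module ((*s) :: 'k::comm_ring_1 \<Rightarrow> 'k ^ 'n \<Rightarrow> 'k ^ 'n)"
  by unfold_locales (simp_all add: vec_eq_iff algebra_simps)

lemma bilinear_bracket_iff:
  "bilinear_bracket m \<longleftrightarrow>
     (\<forall>x y z. m (x + y) z = m x z + m y z) \<and> (\<forall>x y z. m x (y + z) = m x y + m x z) \<and>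
     (\<forall>c x y. m (c *s x) y = c *s m x y) \<and> (\<forall>c x y. m x (c *s y) = c *s m x y)"
  unfolding bilinear_bracket_def module_hom_iff by (auto simp: module_vec)

lemma linear_vec_iff:
  fixes f :: "'k::field ^ 'n \<Rightarrow> 'k ^ 'm"
  shows "Vector_Spaces.linear (*s) (*s) f \<longleftrightarrow>
     (\<forall>x y. f (x + y) = f x + f y) \<and> (\<forall>c x. f (c *s x) = c *s f x)"
  by (simp add: Vector_Spaces.linear_iff vec.vector_space_axioms)

lemma linear_form_iff:
  fixes f :: "'k::field ^ 'n \<Rightarrow> 'k"
  shows "Vector_Spaces.linear (*s) (*) f \<longleftrightarrow>
     (\<forall>x y. f (x + y) = f x + f y) \<and> (\<forall>c x. f (c *s x) = c * f x)"
  by (simp add: Vector_Spaces.linear_iff vec.vector_space_axioms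
      vector_space_over_itself.vector_space_axioms)

locale bilinear_br =
  fixes m :: "('k::comm_ring_1, 'n::finite) bracket"
  assumes bilinear: "bilinear_bracket m"
begin

lemma add_left: "m (x + y) z = m x z + m y z"
  and add_right: "m x (y + z) = m x y + m x z"
  and scale_left: "m (c *s x) y = c *s m x y"
  and scale_right: "m x (c *s y) = c *s m x y"
  using bilinear unfolding bilinear_bracket_iff by blast+

lemma zero_left [simp]: "m 0 y = 0" and zero_right [simp]: "m x 0 = 0"
  using scale_left[of 0 0] scale_right[of _ 0 0] by simp_all

lemma minus_left: "m (- x) y = - m x y" and minus_right: "m x (- y) = - m x y"
  by (metis add.right_inverse add_left zero_left minus_unique)
     (metis add.right_inverse add_right zero_right minus_unique)

lemma diff_left: "m (x - y) z = m x z - m y z" and diff_right: "m x (y - z) = m x y - m x z"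
  using add_left[of x "- y"] add_right[of x y "- z"] by (simp_all add: minus_left minus_right)

lemma sum_left: "m (sum f S) y = (\<Sum>i\<in>S. m (f i) y)"
  and sum_right: "m x (sum f S) = (\<Sum>i\<in>S. m x (f i))"
  by (induction S rule: infinite_finite_induct) (simp_all add: add_left add_right)

lemmas bilinear_simps = add_left add_right scale_left scale_right diff_left diff_right

end

lemma bracket_of_nth: "bracket_of c x y $ k = (\<Sum>i\<in>UNIV. \<Sum>j\<in>UNIV. c i j k * x $ i * y $ j)"
  by (simp add: bracket_of_def)

lemma bilinear_br_bracket_of: "bilinear_br (bracket_of c)"
  by unfold_locales
    (simp add: bilinear_bracket_iff vec_eq_iff bracket_of_nth algebra_simps sum.distrib
      sum_distrib_left)

lemma structure_const_bracket_of [simp]: "structure_const (bracket_of c) = c"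
proof (intro ext)
  fix i j k
  have "structure_const (bracket_of c) i j k =
    (\<Sum>i'\<in>UNIV. \<Sum>j'\<in>UNIV. c i' j' k * (if i' = i then 1 else 0) * (if j' = j then 1 else 0))"
    by (simp add: structure_const_def bracket_of_nth axis_def)
  also have "\<dots> = c i j k"
    by (simp add: mult_delta_right mult_delta_left)
  finally show "structure_const (bracket_of c) i j k = c i j k" .
qed

lemma vec_basis_expansion: "(x :: 'k::comm_ring_1 ^ 'n) = (\<Sum>i\<in>UNIV. x $ i *s axis i 1)"
  by (simp add: vec_eq_iff axis_def mult_delta_right)

lemma (in bilinear_br) bracket_of_structure_const: "bracket_of (structure_const m) = m"
proof (intro ext)
  fix x y
  have "m x y = m (\<Sum>i\<in>UNIV. x $ i *s axis i 1) (\<Sum>j\<in>UNIV. y $ j *s axis j 1)"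
    using vec_basis_expansion[of x] vec_basis_expansion[of y] by simp
  also have "\<dots> = (\<Sum>j\<in>UNIV. \<Sum>i\<in>UNIV. y $ j *s (x $ i *s m (axis i 1) (axis j 1)))"
    by (simp only: sum_left sum_right scale_left scale_right sum_cmul)
  also have "\<dots> = (\<Sum>i\<in>UNIV. \<Sum>j\<in>UNIV. y $ j *s (x $ i *s m (axis i 1) (axis j 1)))"
    by (rule sum.swap)
  finally show "bracket_of (structure_const m) x y = m x y"
    by (simp add: vec_eq_iff bracket_of_nth structure_const_def mult_ac)
qed

lemma base_change_bracket_of: "base_change h (bracket_of c) = bracket_of (\<lambda>i j k. h (c i j k))"
  by (simp add: base_change_def)

section \<open>Commutative 2-step nilpotent brackets\<close>

definition comm_nil :: "('k::comm_ring_1, 'n::finite) bracket \<Rightarrow> bool" where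
  "comm_nil m \<longleftrightarrow> (\<forall>x y. m x y = m y x) \<and> (\<forall>x y z. m (m x y) z = 0)"

lemma comm_nilD:
  assumes "comm_nil m"
  shows "m x y = m y x" "m (m x y) z = 0" "m z (m x y) = 0"
  using assms unfolding comm_nil_def by metis+

lemma leibniz_bracket_comm_nil: "bilinear_br m \<Longrightarrow> comm_nil m \<Longrightarrow> leibniz_bracket m"
  by (simp add: leibniz_bracket_def left_leibniz_def bilinear_br.bilinear comm_nilD)

text \<open>By bilinearity basis vectors decide the property, which becomes a system of polynomial
  equations with integer coefficients in the structure constants. In this form it passes along ring
  homomorphisms, and back along injective ones.\<close>

lemma comm_nil_bracket_of_iff:
  "comm_nil (bracket_of c) \<longleftrightarrow>
     (\<forall>i j k. c i j k = c j i k) \<and> (\<forall>i j l k. (\<Sum>p\<in>UNIV. c i j p * c p l k) = 0)"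
proof -
  interpret bilinear_br "bracket_of c" by (rule bilinear_br_bracket_of)
  let ?m = "bracket_of c"
  have ax: "?m (axis i 1) (axis j 1) $ k = c i j k" for i j k
    using structure_const_bracket_of[of c] by (metis structure_const_def)
  have axv: "?m (axis i 1) (axis j 1) = (\<Sum>p\<in>UNIV. c i j p *s axis p 1)" for i j
    by (subst vec_basis_expansion) (simp add: ax)
  have trip: "?m (?m (axis i 1) (axis j 1)) (axis l 1) $ k = (\<Sum>p\<in>UNIV. c i j p * c p l k)"
    for i j l k
    by (simp only: axv[of i j] sum_left scale_left sum_component vector_smult_component ax)
  show ?thesis
  proof
    assume cn: "comm_nil ?m"
    show "(\<forall>i j k. c i j k = c j i k) \<and> (\<forall>i j l k. (\<Sum>p\<in>UNIV. c i j p * c p l k) = 0)"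
      using comm_nilD(1)[OF cn] comm_nilD(2)[OF cn] by (metis ax trip zero_index)
  next
    assume a: "(\<forall>i j k. c i j k = c j i k) \<and> (\<forall>i j l k. (\<Sum>p\<in>UNIV. c i j p * c p l k) = 0)"
    have "?m x y = ?m y x" for x y
    proof -
      have "(\<Sum>i\<in>UNIV. \<Sum>j\<in>UNIV. c i j k * x $ i * y $ j) = (\<Sum>i\<in>UNIV. \<Sum>j\<in>UNIV. c i j k * y $ i * x $ j)"
        for k
        by (subst sum.swap) (use a in \<open>simp add: mult_ac\<close>)
      then show ?thesis by (simp add: vec_eq_iff bracket_of_nth)
    qed
    moreover have "?m (?m (axis i 1) (axis j 1)) (axis l 1) = 0" for i j l
      using a by (simp add: vec_eq_iff trip)
    then have "?m (?m (axis i 1) (axis j 1)) z = 0" for i j z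
      by (subst vec_basis_expansion[of z]) (simp add: sum_right scale_right)
    then have "?m (?m (axis i 1) y) z = 0" for i y z
      by (subst vec_basis_expansion[of y]) (simp add: sum_right scale_right sum_left scale_left)
    then have "?m (?m x y) z = 0" for x y z
      by (subst vec_basis_expansion[of x]) (simp add: sum_left scale_left)
    ultimately show "comm_nil ?m" by (simp add: comm_nil_def)
  qed
qed

text \<open>Instances below are \<open>fps_to_fls\<close>, \<open>to_ac\<close>,
  \<open>fps_of_poly\<close> and evaluation of polynomials at a point. They link the polynomial,
  formal, generic and specialized brackets.\<close>

locale ring_map =
  fixes h :: "'k::comm_ring_1 \<Rightarrow> 'l::comm_ring_1"
  assumes map_add: "h (x + y) = h x + h y"
    and map_mult: "h (x * y) = h x * h y"
    and map_one: "h 1 = 1"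
begin

lemma map_zero: "h 0 = 0"
  using map_add[of 0 0] by simp

lemma map_diff: "h (x - y) = h x - h y"
  using map_add[of "x - y" y] by simp

lemma map_sum: "h (sum f S) = (\<Sum>i\<in>S. h (f i))"
  by (induction S rule: infinite_finite_induct) (simp_all add: map_zero map_add)

lemma map_numeral: "h (numeral n) = numeral n"
proof -
  have "h (of_nat k) = of_nat k" for k
    by (induction k) (simp_all add: map_zero map_add map_one)
  from this[of "numeral n"] show ?thesis by simp
qed

lemma comm_nil_base_change:
  assumes "comm_nil (bracket_of c)"
  shows "comm_nil (base_change h (bracket_of c))"
proof -
  have "h (\<Sum>p\<in>UNIV. c i j p * c p l k) = 0" for i j l k
    using assms unfolding comm_nil_bracket_of_iff by (simp add: map_zero)
  then show ?thesis
    using assms unfolding base_change_bracket_of comm_nil_bracket_of_iff map_sum map_mult by auto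
qed

lemma comm_nil_base_change_inj:
  assumes "comm_nil (base_change h (bracket_of c))" and "inj h"
  shows "comm_nil (bracket_of c)"
proof -
  have "h (\<Sum>p\<in>UNIV. c i j p * c p l k) = h 0" and "h (c i j k) = h (c j i k)" for i j l k
    using assms(1)
    unfolding base_change_bracket_of comm_nil_bracket_of_iff map_sum map_mult map_zero by auto
  then show ?thesis
    unfolding comm_nil_bracket_of_iff inj_eq[OF assms(2)] by blast
qed

end

section \<open>Squares and commutators in metric Leibniz algebras\<close>

text \<open>Equal arguments in the Leibniz identity make squares annihilate from one side: the left
  identity with x = y gives [[x,x],z] = 0, the right one with y = z gives [x,[y,y]] = 0. Invariance
  and non-degeneracy carry this to the other side.\<close>

lemma metric_leibniz_square_ann:
  assumes "metric_leibniz m"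
  shows "m (m x x) y = 0" "m y (m x x) = 0"
proof -
  from assms obtain B where sym: "\<And>x y. B x y = B y x"
    and inv: "\<And>x y z. B (m x y) z = B x (m y z)"
    and nd: "\<And>x. (\<And>y. B x y = 0) \<Longrightarrow> x = 0"
    and lb: "bilinear_form B" and lz: "leibniz_bracket m"
    unfolding metric_leibniz_def by metis
  have B0: "B x 0 = 0" "B 0 x = 0" for x
    using lb sym[of 0 x] unfolding bilinear_form_def linear_form_iff by (metis mult_zero_left vector_smult_lzero)+
  have cyc: "B (m (m x x) y) z = B y (m z (m x x))" for x y z
    by (metis inv sym)
  have cyc': "B (m y (m x x)) z = B y (m (m x x) z)" for x y z
    by (rule inv)
  from lz interpret bilinear_br m by unfold_locales (simp add: leibniz_bracket_def)
  from lz have "left_leibniz m \<or> right_leibniz m" by (simp add: leibniz_bracket_def)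
  then have "(\<forall>x y. m (m x x) y = 0) \<or> (\<forall>x y. m y (m x x) = 0)"
    unfolding left_leibniz_def right_leibniz_def
    by (metis add_cancel_right_left add_0 diff_self)
  then have "(\<forall>x y. m (m x x) y = 0) \<and> (\<forall>x y. m y (m x x) = 0)"
    by (metis cyc cyc' B0 nd)
  then show "m (m x x) y = 0" "m y (m x x) = 0" by blast+
qed

text \<open>Squares are central by the Leibniz identity and cyclicity of \<open>B (m x y) z\<close>, so the commutator
  of \<open>u\<close> and \<open>v\<close> is orthogonal to the four spanning vectors, two of which are combinations of
  squares.\<close>

lemma metric_leibniz_comm_nil:
  fixes m :: "('k::field, 'n::finite) bracket"
  assumes met: "metric_leibniz m" and two: "(2::'k) \<noteq> 0"
    and span: "\<And>x. \<exists>\<alpha> \<beta> \<gamma> \<delta>.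
      x = \<alpha> *s u + \<beta> *s v + \<gamma> *s m v v + \<delta> *s (m u v + m v u)"
  shows "comm_nil m"
proof -
  from met obtain B where sym: "\<And>x y. B x y = B y x"
    and inv: "\<And>x y z. B (m x y) z = B x (m y z)"
    and nd: "\<And>x. (\<And>y. B x y = 0) \<Longrightarrow> x = 0"
    and lb: "bilinear_form B" and lz: "leibniz_bracket m"
    unfolding metric_leibniz_def by metis
  from lz interpret bilinear_br m by unfold_locales (simp add: leibniz_bracket_def)
  have Badd: "B x (y + z) = B x y + B x z" "B (x + y) z = B x z + B y z"
    and Bscale: "B x (c *s y) = c * B x y" for x y z c
    using lb unfolding bilinear_form_def linear_form_iff by blast+
  have B0: "B x 0 = 0" for x
    using Bscale[of x 0 0] by simp
  have Bdiff: "B (x - y) z = B x z - B y z" for x y z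
    using Badd(2)[of "x - y" y z] by simp
  \<comment> \<open>Polarization: an anticommutator is a combination of squares, so it annihilates
    from both sides.\<close>
  have pol: "m x y + m y x = m (x + y) (x + y) - m x x - m y y" for x y
    by (simp add: bilinear_simps)
  have ann: "m (m x y + m y x) z = 0" "m z (m x y + m y x) = 0" for x y z
    unfolding pol by (simp_all add: diff_left diff_right metric_leibniz_square_ann[OF met])
  define q where "q = m u v - m v u"
  \<comment> \<open>B([u,v],u) = B(u,[v,u]) = B([v,u],u) by invariance and symmetry, and similarly
    with v.\<close>
  have "B q u = 0" "B q v = 0"
    unfolding q_def Bdiff by (metis inv sym diff_self)+
  moreover have orth: "B q s = 0" if "\<And>z. m z s = 0" for s
    unfolding q_def Bdiff inv that by (simp add: B0)
  have "B q (m v v) = 0" "B q (m u v + m v u) = 0"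
    by (rule orth; simp add: ann metric_leibniz_square_ann[OF met])+
  ultimately have "B q x = 0" for x
    using span[of x] by (auto simp del: vector_add_ldistrib simp add: Badd(1) Bscale)
  then have "q = 0" by (rule nd)
  then have uv: "m u v = m v u" by (simp add: q_def)
  define b where "b = m u v + m v u"
  have annb: "m b z = 0" "m z b = 0" for z
    unfolding b_def by (rule ann)+
  have comm: "m x y = m y x" for x y
  proof -
    obtain \<alpha> \<beta> \<gamma> \<delta> \<alpha>' \<beta>' \<gamma>' \<delta>'
      where x: "x = \<alpha> *s u + \<beta> *s v + \<gamma> *s m v v + \<delta> *s b"
        and y: "y = \<alpha>' *s u + \<beta>' *s v + \<gamma>' *s m v v + \<delta>' *s b"
      using span[of x] span[of y] unfolding b_def by blast
    show ?thesis
      unfolding x y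
      by (simp add: bilinear_simps annb metric_leibniz_square_ann[OF met] uv vec_eq_iff algebra_simps)
  qed
  moreover have "m (m x y) z = 0" for x y z
  proof -
    \<comment> \<open>By commutativity the anticommutator of x and y is 2[x,y], and it annihilates
      z.\<close>
    have "m (m x y) z + m (m x y) z = 0"
      using ann(1)[of x y z] by (simp only: comm[of y x] add_left)
    then have "2 * m (m x y) z $ i = 0" for i
      by (metis mult_2 vector_add_component zero_index)
    then show ?thesis using two by (simp add: vec_eq_iff)
  qed
  ultimately show ?thesis by (simp add: comm_nil_def)
qed

section \<open>Frames made of e1, e2 and two further vectors\<close>

definition minor34 :: "'k::comm_ring_1 ^ 4 \<Rightarrow> 'k ^ 4 \<Rightarrow> 'k" where
  "minor34 x y = x $ 3 * y $ 4 - x $ 4 * y $ 3"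

definition lin_comb4 :: "'k::comm_ring_1 ^ 'n \<Rightarrow> 'k ^ 'n \<Rightarrow> 'k ^ 'n \<Rightarrow> 'k ^ 'n \<Rightarrow> 'k ^ 4 \<Rightarrow> 'k ^ 'n" where
  "lin_comb4 u v a b x = x $ 1 *s u + x $ 2 *s v + x $ 3 *s a + x $ 4 *s b"

lemma axis_4_nth [simp]:
  "axis 1 (c::'k::zero) $ (1::4) = c" "axis 1 (c::'k::zero) $ (2::4) = 0"
  "axis 1 (c::'k::zero) $ (3::4) = 0" "axis 1 (c::'k::zero) $ (4::4) = 0"
  "axis 2 (c::'k::zero) $ (1::4) = 0" "axis 2 (c::'k::zero) $ (2::4) = c"
  "axis 2 (c::'k::zero) $ (3::4) = 0" "axis 2 (c::'k::zero) $ (4::4) = 0"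
  "axis 3 (c::'k::zero) $ (1::4) = 0" "axis 3 (c::'k::zero) $ (2::4) = 0"
  "axis 3 (c::'k::zero) $ (3::4) = c" "axis 3 (c::'k::zero) $ (4::4) = 0"
  "axis 4 (c::'k::zero) $ (1::4) = 0" "axis 4 (c::'k::zero) $ (2::4) = 0"
  "axis 4 (c::'k::zero) $ (3::4) = 0" "axis 4 (c::'k::zero) $ (4::4) = c"
  by (simp_all add: axis_def)

text \<open>Cramer's rule in the last two coordinates: \<open>minor34 a b\<close> is the determinant
  of the family \<open>axis 1 1\<close>, \<open>axis 2 1\<close>, \<open>a\<close>,
  \<open>b\<close>. Its inverse \<open>e\<close> is a parameter so that power series rings are
  covered along with fields.\<close>

lemma frame_expansion:
  fixes x a b :: "'k::comm_ring_1 ^ 4"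
  assumes "minor34 a b * e = 1"
  defines "\<gamma> \<equiv> minor34 x b * e" and "\<delta> \<equiv> minor34 a x * e"
  shows "x = (x$1 - \<gamma> * a$1 - \<delta> * b$1) *s axis 1 1 + (x$2 - \<gamma> * a$2 - \<delta> * b$2) *s axis 2 1
    + \<gamma> *s a + \<delta> *s b"
proof -
  have "x $ 3 * (minor34 a b * e) = \<gamma> * a $ 3 + \<delta> * b $ 3"
    and "x $ 4 * (minor34 a b * e) = \<gamma> * a $ 4 + \<delta> * b $ 4"
    unfolding \<gamma>_def \<delta>_def minor34_def by (simp_all add: algebra_simps)
  then show ?thesis
    unfolding vec_eq_iff forall_4 assms(1) by simp
qed

lemma frame_independent:
  fixes a b :: "'k::comm_ring_1 ^ 4"
  assumes e: "minor34 a b * e = 1"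
    and z: "\<alpha> *s axis 1 1 + \<beta> *s axis 2 1 + \<gamma> *s a + \<delta> *s b = 0"
  shows "\<alpha> = 0" "\<beta> = 0" "\<gamma> = 0" "\<delta> = 0"
proof -
  have z1: "\<alpha> + \<gamma> * a$1 + \<delta> * b$1 = 0" and z2: "\<beta> + \<gamma> * a$2 + \<delta> * b$2 = 0"
    and z3: "\<gamma> * a$3 + \<delta> * b$3 = 0" and z4: "\<gamma> * a$4 + \<delta> * b$4 = 0"
    using z by (simp_all add: vec_eq_iff forall_4)
  have "\<gamma> * (minor34 a b * e)
      = e * (b$4 * (\<gamma> * a$3 + \<delta> * b$3) - b$3 * (\<gamma> * a$4 + \<delta> * b$4))"
    unfolding minor34_def by (simp add: algebra_simps)
  moreover have "\<delta> * (minor34 a b * e)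
      = e * (a$3 * (\<gamma> * a$4 + \<delta> * b$4) - a$4 * (\<gamma> * a$3 + \<delta> * b$3))"
    unfolding minor34_def by (simp add: algebra_simps)
  ultimately show \<gamma>: "\<gamma> = 0" and \<delta>: "\<delta> = 0" unfolding e z3 z4 by simp_all
  show "\<alpha> = 0" "\<beta> = 0" using z1 z2 by (simp_all add: \<gamma> \<delta>)
qed

lemma bij_lin_comb4:
  fixes a b :: "'k::comm_ring_1 ^ 4"
  assumes e: "minor34 a b * e = 1"
  shows "bij (lin_comb4 (axis 1 1 + s *s axis 2 1) (axis 2 1) a b)" (is "bij ?F")
proof (rule bijI)
  show "inj ?F"
  proof (rule injI)
    fix x y assume "?F x = ?F y"
    then have "(x$1 - y$1) *s axis 1 1 + (s * (x$1 - y$1) + (x$2 - y$2)) *s axis 2 1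
        + (x$3 - y$3) *s a + (x$4 - y$4) *s b = 0"
      unfolding lin_comb4_def vec_eq_iff by (simp add: algebra_simps)
    from frame_independent[OF e this] show "x = y"
      by (simp add: vec_eq_iff forall_4)
  qed
  show "surj ?F"
  proof (unfold surj_def, intro allI)
    fix x :: "'k ^ 4"
    define \<gamma> where "\<gamma> = minor34 x b * e"
    define \<delta> where "\<delta> = minor34 a x * e"
    define \<alpha> where "\<alpha> = x$1 - \<gamma> * a$1 - \<delta> * b$1"
    define \<beta> where "\<beta> = x$2 - \<gamma> * a$2 - \<delta> * b$2"
    \<comment> \<open>The first frame vector contributes s \<alpha> along e2, which the second
      coordinate \<beta> - s \<alpha> cancels.\<close>
    have "?F (\<alpha> *s axis 1 1 + (\<beta> - s * \<alpha>) *s axis 2 1 + \<gamma> *s axis 3 1 + \<delta> *s axis 4 1)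
        = \<alpha> *s axis 1 1 + \<beta> *s axis 2 1 + \<gamma> *s a + \<delta> *s b"
      unfolding lin_comb4_def by (simp add: vec_eq_iff algebra_simps)
    also have "\<dots> = x"
      using frame_expansion[OF e, of x] by (simp add: \<alpha>_def \<beta>_def \<gamma>_def \<delta>_def)
    finally show "\<exists>y. x = ?F y" by metis
  qed
qed

lemma lin_comb4_linear:
  "lin_comb4 u v a b (x + y) = lin_comb4 u v a b x + lin_comb4 u v a b y"
  "lin_comb4 u v a b (c *s x) = c *s lin_comb4 u v a b x"
  by (simp_all add: lin_comb4_def vec_eq_iff algebra_simps)

section \<open>Normal form\<close>

text \<open>The algebra with squares \<open>(x e\<^sub>1 + y e\<^sub>2)\<^sup>2 = (D x\<^sup>2 + y\<^sup>2) e\<^sub>3 + 2 x y e\<^sub>4\<close>, so that \<open>D\<close> is the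
  discriminant of this pencil of binary quadratic forms.\<close>

definition nf_consts :: "'k::comm_ring_1 \<Rightarrow> 4 \<Rightarrow> 4 \<Rightarrow> 4 \<Rightarrow> 'k" where
  "nf_consts D i j k =
     (if (i, j, k) \<in> {(1, 2, 4), (2, 1, 4), (2, 2, 3)} then 1
      else if (i, j, k) = (1, 1, 3) then D else 0)"

definition nf_bracket :: "'k::comm_ring_1 \<Rightarrow> ('k, 4) bracket" where
  "nf_bracket D = bracket_of (nf_consts D)"

lemma nf_bracket_nth:
  "nf_bracket D x y $ 1 = 0" "nf_bracket D x y $ 2 = 0"
  "nf_bracket D x y $ 3 = D * x$1 * y$1 + x$2 * y$2"
  "nf_bracket D x y $ 4 = x$1 * y$2 + x$2 * y$1"
  by (simp_all add: nf_bracket_def bracket_of_nth sum_4 nf_consts_def)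

lemma nf_bracket_zero: "nf_bracket 0 = R20_0"
  unfolding nf_bracket_def R20_0_def nf_consts_def by (intro arg_cong[of _ _ bracket_of] ext) simp

lemma base_change_nf_bracket: "h 0 = 0 \<Longrightarrow> h 1 = 1 \<Longrightarrow> base_change h (nf_bracket D) = nf_bracket (h D)"
  unfolding nf_bracket_def base_change_bracket_of nf_consts_def
  by (intro arg_cong[of _ _ bracket_of] ext) simp

lemma bilinear_br_nf_bracket: "bilinear_br (nf_bracket D)"
  unfolding nf_bracket_def by (rule bilinear_br_bracket_of)

lemma comm_nil_nf_bracket: "comm_nil (nf_bracket D)"
  by (simp add: comm_nil_def vec_eq_iff forall_4 nf_bracket_nth algebra_simps)

text \<open>For a commutative 2-step nilpotent bracket on \<open>k\<^sup>4\<close> in which \<open>e\<^sub>1, e\<^sub>2, e\<^sub>2\<^sup>2, e\<^sub>1e\<^sub>2\<close> is a basis,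
  \<open>e\<^sub>1\<^sup>2 = \<gamma> e\<^sub>2\<^sup>2 + \<delta> e\<^sub>1e\<^sub>2\<close>, and \<open>pencil_disc\<close> is \<open>4\<gamma> + \<delta>\<^sup>2\<close> times the square of \<open>frame_det\<close>.\<close>

definition frame_det :: "('k::comm_ring_1, 4) bracket \<Rightarrow> 'k" where
  "frame_det m = minor34 (m (axis 2 1) (axis 2 1)) (m (axis 1 1) (axis 2 1))"

definition pencil_disc :: "('k::comm_ring_1, 4) bracket \<Rightarrow> 'k" where
  "pencil_disc m =
     4 * minor34 (m (axis 1 1) (axis 1 1)) (m (axis 1 1) (axis 2 1)) * frame_det m
     + (minor34 (m (axis 2 1) (axis 2 1)) (m (axis 1 1) (axis 1 1)))\<^sup>2"

text \<open>With \<open>e\<close> and \<open>half\<close> the inverses of \<open>frame_det m\<close>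
  and 2, this is - \<delta> / 2.\<close>

definition nf_shift :: "'k::comm_ring_1 \<Rightarrow> 'k \<Rightarrow> ('k, 4) bracket \<Rightarrow> 'k" where
  "nf_shift e half m = - half * e * minor34 (m (axis 2 1) (axis 2 1)) (m (axis 1 1) (axis 1 1))"

text \<open>For bilinear \<open>m\<close> the basis goes to e1 + s e2, e2, e2^2 and (e1 + s e2) e2,
  so the last two images are products of the first two.\<close>

definition nf_map :: "'k::comm_ring_1 \<Rightarrow> ('k, 4) bracket \<Rightarrow> 'k ^ 4 \<Rightarrow> 'k ^ 4" where
  "nf_map s m = lin_comb4 (axis 1 1 + s *s axis 2 1) (axis 2 1) (m (axis 2 1) (axis 2 1))
     (m (axis 1 1) (axis 2 1) + s *s m (axis 2 1) (axis 2 1))"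

text \<open>Completing the square: \<open>s = - \<delta> / 2\<close> makes \<open>(e\<^sub>1 + s e\<^sub>2)\<^sup>2\<close> a multiple of \<open>e\<^sub>2\<^sup>2\<close>.\<close>

lemma nf_map_normal_form:
  fixes m :: "('k::comm_ring_1, 4) bracket"
  assumes "bilinear_br m" and cn: "comm_nil m"
    and e: "frame_det m * e = 1" and half: "2 * half = 1"
  defines "s \<equiv> nf_shift e half m"
  shows "bij (nf_map s m)"
    and "nf_map s m (nf_bracket (half\<^sup>2 * e\<^sup>2 * pencil_disc m) x y) = m (nf_map s m x) (nf_map s m y)"
proof -
  interpret bilinear_br m by fact
  note c = comm_nilD[OF cn]
  define a where "a = m (axis 2 1) (axis 2 1)"
  define b where "b = m (axis 1 1) (axis 2 1)"
  define w where "w = m (axis 1 1) (axis 1 1)"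
  have ann: "m a z = 0" "m z a = 0" "m b z = 0" "m z b = 0" "m w z = 0" "m z w = 0" for z
    unfolding a_def b_def w_def by (simp_all add: c)
  have b': "m (axis 2 1) (axis 1 1) = b" unfolding b_def by (rule c)
  have e': "minor34 a b * e = 1" using e by (simp add: frame_det_def a_def b_def)
  define \<gamma> where "\<gamma> = minor34 w b * e"
  define \<delta> where "\<delta> = minor34 a w * e"
  obtain \<alpha> \<beta> where w: "w = \<alpha> *s axis 1 1 + \<beta> *s axis 2 1 + \<gamma> *s a + \<delta> *s b"
    using frame_expansion[OF e', of w] unfolding \<gamma>_def \<delta>_def by blast
  \<comment> \<open>Nilpotency makes this product zero, so independence of the frame gives \<alpha>
    = \<beta> = 0 and e1^2 lies in the span of a and b.\<close>
  have "m w (axis 2 1) = \<alpha> *s b + \<beta> *s a"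
    by (subst w) (simp add: bilinear_simps ann flip: a_def b_def)
  then have "0 *s axis 1 1 + 0 *s axis 2 1 + \<beta> *s a + \<alpha> *s b = 0"
    by (simp add: ann add.commute)
  from frame_independent(3,4)[OF e' this] have w: "w = \<gamma> *s a + \<delta> *s b"
    by (subst w) simp
  have s: "s = - half * \<delta>"
    by (simp add: s_def nf_shift_def \<delta>_def a_def w_def mult_ac)
  have s2: "2 * s + \<delta> = 0"
    unfolding s using half by (simp flip: mult.assoc)
  \<comment> \<open>This is the coefficient in (e1 + s e2)^2 = (\<gamma> + s^2) a + (\<delta> + 2 s)
    b, whose second term vanishes.\<close>
  have D: "half\<^sup>2 * e\<^sup>2 * pencil_disc m = \<gamma> + s\<^sup>2"
  proof -
    have "pencil_disc m = 4 * minor34 w b * minor34 a b + (minor34 a w)\<^sup>2"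
      by (simp add: pencil_disc_def frame_det_def a_def b_def w_def)
    then have "half\<^sup>2 * e\<^sup>2 * pencil_disc m
        = (2 * half)\<^sup>2 * (minor34 a b * e) * \<gamma> + (- half * \<delta>)\<^sup>2"
      by (simp add: \<gamma>_def \<delta>_def power2_eq_square algebra_simps)
    then show ?thesis
      unfolding s half e' by simp
  qed
  have map: "nf_map s m = lin_comb4 (axis 1 1 + s *s axis 2 1) (axis 2 1) a (b + s *s a)"
    by (simp add: nf_map_def a_def b_def)
  have "minor34 a (b + s *s a) * e = 1"
    using e' by (simp add: minor34_def algebra_simps)
  then show "bij (nf_map s m)"
    unfolding map by (rule bij_lin_comb4)
  have \<delta>: "\<delta> = - 2 * s" using s2 by (simp add: eq_neg_iff_add_eq_0 add.commute)
  show "nf_map s m (nf_bracket (half\<^sup>2 * e\<^sup>2 * pencil_disc m) x y) = m (nf_map s m x) (nf_map s m y)"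
    unfolding D map lin_comb4_def nf_bracket_nth
    by (simp add: bilinear_simps ann b' w \<delta> flip: a_def b_def w_def)
      (simp add: vec_eq_iff algebra_simps power2_eq_square)
qed

section \<open>Splitting into two copies of \<open>mu1\<close>\<close>

lemma sum_UNIV_plus: "(\<Sum>i\<in>(UNIV :: ('a::finite + 'b::finite) set). f i) = (\<Sum>i\<in>UNIV. f (Inl i)) + (\<Sum>i\<in>UNIV. f (Inr i))"
  by (simp add: UNIV_Plus_UNIV[symmetric] sum.Plus del: UNIV_Plus_UNIV)

lemma direct_sum_mu1_eq:
  "direct_sum mu1 mu1 = bracket_of
     (\<lambda>i j k. if (i, j, k) = (Inl 1, Inl 1, Inl 2) \<or> (i, j, k) = (Inr 1, Inr 1, Inr 2) then 1 else 0)"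
  unfolding fun_eq_iff vec_eq_iff
proof (intro allI)
  fix x y and k :: "2 + 2"
  show "direct_sum mu1 mu1 x y $ k = bracket_of (\<lambda>i j k. if (i, j, k) = (Inl 1, Inl 1, Inl 2)
      \<or> (i, j, k) = (Inr 1, Inr 1, Inr 2) then 1 else 0) x y $ k"
    by (cases k) (simp_all add: direct_sum_def mu1_def bracket_of_nth sum_UNIV_plus sum_2 if_distrib cong: if_cong)
qed

lemma base_change_direct_sum_mu1_nth:
  fixes h :: "complex \<Rightarrow> 'k::comm_ring_1"
  assumes "h 0 = 0" "h 1 = 1"
  shows "base_change h (direct_sum mu1 mu1) x y $ Inl 1 = 0"
    and "base_change h (direct_sum mu1 mu1) x y $ Inl 2 = x $ Inl 1 * y $ Inl 1"
    and "base_change h (direct_sum mu1 mu1) x y $ Inr 1 = 0"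
    and "base_change h (direct_sum mu1 mu1) x y $ Inr 2 = x $ Inr 1 * y $ Inr 1"
  by (simp_all add: direct_sum_mu1_eq base_change_bracket_of bracket_of_nth sum_UNIV_plus sum_2 assms)

lemma forall_2_plus_2: "(\<forall>i :: 2 + 2. P i) \<longleftrightarrow> P (Inl 1) \<and> P (Inl 2) \<and> P (Inr 1) \<and> P (Inr 2)"
  by (auto simp: split_sum_all forall_2)

text \<open>With \<open>r\<^sup>2 = D\<close> the vectors \<open>e\<^sub>1 \<plusminus> r e\<^sub>2\<close> annihilate each other.\<close>

lemma nf_bracket_isomorphic_direct_sum:
  fixes r :: "'k::field"
  assumes r: "r\<^sup>2 = D" and "D \<noteq> 0" and two: "(2::'k) \<noteq> 0" and h: "h 0 = 0" "h 1 = 1"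
  shows "alg_isomorphic (nf_bracket D) (base_change h (direct_sum mu1 mu1))"
proof -
  have r0: "r \<noteq> 0" using assms by auto
  \<comment> \<open>Coordinates with respect to the generators e1 + r e2, e1 - r e2 and their
    squares 2 D e3 + 2 r e4, 2 D e3 - 2 r e4; \<open>g\<close> is the inverse.\<close>
  define f :: "'k ^ 4 \<Rightarrow> 'k ^ (2 + 2)" where
    "f x = (\<chi> k. case k of
        Inl i \<Rightarrow> if i = 1 then (x$1 + x$2 / r) / 2 else (x$3 / (2 * D) + x$4 / (2 * r)) / 2
      | Inr i \<Rightarrow> if i = 1 then (x$1 - x$2 / r) / 2 else (x$3 / (2 * D) - x$4 / (2 * r)) / 2)" for x
  have f_nth: "f x $ Inl 1 = (x$1 + x$2 / r) / 2" "f x $ Inl 2 = (x$3 / (2 * D) + x$4 / (2 * r)) / 2"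
    "f x $ Inr 1 = (x$1 - x$2 / r) / 2" "f x $ Inr 2 = (x$3 / (2 * D) - x$4 / (2 * r)) / 2" for x
    by (simp_all add: f_def)
  define g :: "'k ^ (2 + 2) \<Rightarrow> 'k ^ 4" where
    "g y = (y $ Inl 1 + y $ Inr 1) *s axis 1 1 + (r * (y $ Inl 1 - y $ Inr 1)) *s axis 2 1
      + (2 * D * (y $ Inl 2 + y $ Inr 2)) *s axis 3 1 + (2 * r * (y $ Inl 2 - y $ Inr 2)) *s axis 4 1" for y
  have four: "(4::'k) \<noteq> 0"
    using two by (metis mult_2 mult_eq_0_iff numeral_Bit0)
  have eight: "(8::'k) \<noteq> 0"
    using two four by (metis mult_2 mult_eq_0_iff numeral_Bit0)
  have sixteen: "(16::'k) \<noteq> 0"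
    using two eight by (metis mult_2 mult_eq_0_iff numeral_Bit0)
  have "f (g y) = y" for y
    unfolding vec_eq_iff forall_2_plus_2 f_nth
    using r0 two four eight sixteen \<open>D \<noteq> 0\<close> by (simp add: g_def field_simps)
  moreover have "g (f x) = x" for x
    unfolding g_def f_nth vec_eq_iff forall_4
    using r0 two four eight sixteen \<open>D \<noteq> 0\<close> by (simp add: field_simps)
  ultimately have "bij f" by (metis bijI')
  moreover have "f (x + y) = f x + f y" "f (c *s x) = c *s f x" for x y c
    unfolding vec_eq_iff forall_2_plus_2
    by (simp_all add: f_nth add_divide_distrib diff_divide_distrib algebra_simps)
  moreover have "f (nf_bracket D x y) = base_change h (direct_sum mu1 mu1) (f x) (f y)" for x y
    unfolding vec_eq_iff forall_2_plus_2
    using r0 two four eight sixteen r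
    by (simp add: f_nth nf_bracket_nth base_change_direct_sum_mu1_nth[OF h] r[symmetric])
      (simp add: field_simps power2_eq_square)
  ultimately show ?thesis
    unfolding alg_isomorphic_def linear_vec_iff by blast
qed

lemma alg_isomorphic_transfer:
  fixes m :: "('k::field, 'n::finite) bracket" and m' :: "('k, 'l::finite) bracket"
    and m'' :: "('k, 'j::finite) bracket"
  assumes "bij F" and "\<And>x y. F (x + y) = F x + F y" and "\<And>c x. F (c *s x) = c *s F x"
    and "\<And>x y. F (m x y) = m' (F x) (F y)" and "alg_isomorphic m m''"
  shows "alg_isomorphic m' m''"
proof -
  from assms(5) obtain f where f: "bij f" "\<And>x y. f (x + y) = f x + f y" "\<And>c x. f (c *s x) = c *s f x"
    "\<And>x y. f (m x y) = m'' (f x) (f y)"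
    unfolding alg_isomorphic_def linear_vec_iff by auto
  define G where "G = inv_into UNIV F"
  have G: "F (G x) = x" "G (F y) = y" for x y
    using assms(1) by (simp_all add: G_def bij_is_surj surj_f_inv_f bij_is_inj)
  have "G (x + y) = G x + G y" "G (c *s x) = c *s G x" "G (m' x y) = m (G x) (G y)" for x y c
    by (metis G assms(2-4))+
  moreover have "bij G"
    unfolding G_def using assms(1) by (rule bij_imp_bij_inv)
  ultimately show ?thesis
    unfolding alg_isomorphic_def linear_vec_iff
    by (intro exI[of _ "f \<circ> G"]) (simp add: f bij_comp)
qed

text \<open>The normal form has D = \<open>pencil_disc m\<close> / (2 \<open>frame_det m\<close>)^2,
  which is nonzero and has a square root. The parameter \<open>h\<close> serves both the closure of
  C((t)) and, as the identity, C itself.\<close>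

lemma comm_nil_isomorphic_direct_sum:
  fixes m :: "('k::field, 4) bracket"
  assumes "bilinear_br m" "comm_nil m" "frame_det m \<noteq> 0" "pencil_disc m \<noteq> 0"
    and two: "(2::'k) \<noteq> 0" and sqrt: "\<And>D::'k. \<exists>r. r\<^sup>2 = D" and h: "h 0 = 0" "h 1 = 1"
  shows "alg_isomorphic m (base_change h (direct_sum mu1 mu1))"
proof -
  define e where "e = inverse (frame_det m)"
  define D where "D = (1 / 2)\<^sup>2 * e\<^sup>2 * pencil_disc m"
  define F where "F = nf_map (nf_shift e (1 / 2) m) m"
  have e: "frame_det m * e = 1" and half: "2 * (1 / 2) = (1 :: 'k)"
    using assms by (simp_all add: e_def)
  note F = nf_map_normal_form[OF assms(1,2) e half, folded D_def F_def]
  from sqrt obtain r where "r\<^sup>2 = D" by blast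
  moreover have "D \<noteq> 0" using assms by (simp add: D_def e_def)
  ultimately have iso: "alg_isomorphic (nf_bracket D) (base_change h (direct_sum mu1 mu1))"
    by (rule nf_bracket_isomorphic_direct_sum[OF _ _ two h])
  show ?thesis
    by (rule alg_isomorphic_transfer[where m = "nf_bracket D", OF F(1) _ _ F(2) iso])
      (simp_all add: F_def nf_map_def lin_comb4_linear)
qed

lemma bracket_of_axis_nth: "bracket_of c (axis i 1) (axis j 1) $ k = c i j k"
  using structure_const_bracket_of[of c] by (metis structure_const_def)

text \<open>Both quantities are integer polynomials in the structure constants.\<close>

lemma (in ring_map) frame_det_base_change: "frame_det (base_change h (bracket_of c)) = h (frame_det (bracket_of c))"
  and pencil_disc_base_change: "pencil_disc (base_change h (bracket_of c)) = h (pencil_disc (bracket_of c))"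
  unfolding frame_det_def pencil_disc_def base_change_bracket_of minor34_def bracket_of_axis_nth
  by (simp_all add: map_add map_diff map_mult map_numeral power2_eq_square)

lemma ring_map_to_fls: "ring_map (fps_to_fls :: complex fps \<Rightarrow> complex fls)"
  by unfold_locales (simp_all add: fls_times_fps_to_fls)

lemma ring_map_to_ac: "ring_map (to_ac :: 'k::field \<Rightarrow> _)"
  by unfold_locales simp_all

lemma ring_map_poly: "ring_map (\<lambda>p :: 'k::comm_ring_1 poly. poly p t)"
  by unfold_locales simp_all

lemma ring_map_fps_of_poly: "ring_map (fps_of_poly :: 'k::comm_ring_1 poly \<Rightarrow> _)"
  by unfold_locales (simp_all add: fps_of_poly_add fps_of_poly_mult)

lemma exists_square_root: "\<exists>r :: 'k::alg_closed_field. r\<^sup>2 = D"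
proof -
  have "\<exists>x. poly [:- D, 0, 1:] x = 0"
    by (rule alg_closed_imp_poly_has_root) simp
  then show ?thesis by (auto simp: power2_eq_square algebra_simps)
qed

text \<open>The form pairs e1 with e3 and e2 with e4. Then B([x,y],z) = D x1 y1 z1 + x2 y2 z1 + x1
  y2 z2 + x2 y1 z2 is totally symmetric, whence invariance.\<close>

lemma metric_leibniz_nf_bracket: "metric_leibniz (nf_bracket (D :: 'k::field))"
proof -
  define B :: "'k ^ 4 \<Rightarrow> 'k ^ 4 \<Rightarrow> 'k" where
    "B x y = x$1 * y$3 + x$3 * y$1 + x$2 * y$4 + x$4 * y$2" for x y
  have "bilinear_form B"
    unfolding bilinear_form_def linear_form_iff by (simp add: B_def algebra_simps)
  moreover have "B x y = B y x" "B (nf_bracket D x y) z = B x (nf_bracket D y z)" for x y z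
    by (simp_all add: B_def nf_bracket_nth algebra_simps)
  moreover have "x = 0" if "\<forall>y. B x y = 0" for x
  proof -
    have "B x (axis i 1) = 0" for i using that by blast
    from this[of 1] this[of 2] this[of 3] this[of 4] show ?thesis
      by (simp add: B_def vec_eq_iff forall_4)
  qed
  ultimately show ?thesis
    unfolding metric_leibniz_def
    by (intro conjI exI[of _ B] allI impI
        leibniz_bracket_comm_nil[OF bilinear_br_nf_bracket comm_nil_nf_bracket])
qed

lemma bilinear_br_base_change: "bilinear_br (base_change h m)"
  unfolding base_change_def by (rule bilinear_br_bracket_of)

section \<open>Formal deformations\<close>

text \<open>Reading off the coefficients of t^n on basis vectors turns a C[[t]]-linear map into the
  data that an equivalence of deformations requires.\<close>

lemma formal_map_coefficients:
  fixes F :: "complex fps ^ 'n \<Rightarrow> complex fps ^ 'n"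
  assumes add: "\<And>x y. F (x + y) = F x + F y" and scale: "\<And>c x. F (c *s x) = c *s F x"
  defines "\<Phi> \<equiv> \<lambda>n (x :: complex ^ 'n). \<chi> k. \<Sum>i\<in>UNIV. fps_nth (F (axis i 1) $ k) n * x $ i"
  shows "formal_map \<Phi> = F" "Vector_Spaces.linear (*s) (*s) (\<Phi> n)"
proof -
  have ax: "\<Phi> n (axis i 1) $ k = fps_nth (F (axis i 1) $ k) n" for n i k
    by (simp add: \<Phi>_def axis_def mult_delta_right)
  have sum: "F (sum g S) = (\<Sum>i\<in>S. F (g i))" for g and S :: "'n set"
    using scale[of 0 0] by (induction S rule: infinite_finite_induct) (simp_all add: add)
  show "formal_map \<Phi> = F"
  proof
    fix x
    have "F x = (\<Sum>i\<in>UNIV. x $ i *s F (axis i 1))"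
      by (subst vec_basis_expansion[of x]) (simp add: sum scale)
    then show "formal_map \<Phi> x = F x"
      by (simp add: formal_map_def ax vec_eq_iff fps_nth_inverse mult.commute)
  qed
  show "Vector_Spaces.linear (*s) (*s) (\<Phi> n)"
    unfolding linear_vec_iff \<Phi>_def
    by (simp add: vec_eq_iff algebra_simps sum.distrib sum_distrib_left)
qed

text \<open>The map is the identity modulo t, so a kernel vector vanishes coefficient by
  coefficient. Injectivity makes \<open>inv_into\<close> a genuine left inverse.\<close>

lemma inj_formal_map:
  fixes \<Phi> :: "nat \<Rightarrow> complex ^ 'n \<Rightarrow> complex ^ 'n::finite"
  assumes \<Phi>0: "\<Phi> 0 = id"
  shows "inj (formal_map \<Phi>)"
proof (rule injI)
  fix x y :: "complex fps ^ 'n"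
  assume eq: "formal_map \<Phi> x = formal_map \<Phi> y"
  define M where "M k i = Abs_fps (\<lambda>n. \<Phi> n (axis i 1) $ k)" for k i
  define z where "z i = x $ i - y $ i" for i
  have Mz: "(\<Sum>i\<in>UNIV. M k i * z i) = 0" for k
    using arg_cong[OF eq, of "\<lambda>v. v $ k"]
    by (simp add: formal_map_def M_def z_def right_diff_distrib sum_subtractf)
  have "fps_nth (z k) n = 0" for k n
  proof (induction n arbitrary: k rule: less_induct)
    case (less n)
    \<comment> \<open>All other terms of the convolution contain a coefficient of z of index below
      n, zero by induction.\<close>
    have "fps_nth (M k i * z i) n = fps_nth (M k i) 0 * fps_nth (z i) n" for i
      unfolding fps_mult_nth
      by (subst sum.remove[of _ 0]) (use less in \<open>auto intro!: sum.neutral\<close>)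
    then have "fps_nth (\<Sum>i\<in>UNIV. M k i * z i) n = (\<Sum>i\<in>UNIV. (if k = i then 1 else 0) * fps_nth (z i) n)"
      by (simp add: fps_sum_nth M_def \<Phi>0 axis_def)
    also have "\<dots> = fps_nth (z k) n" by (simp add: mult_delta_left)
    finally show ?case by (simp add: Mz)
  qed
  then show "x = y"
    by (simp add: z_def vec_eq_iff fps_eq_iff)
qed

lemma formal_map_zero: "formal_map \<Phi> 0 = 0"
  by (simp add: formal_map_def vec_eq_iff)

lemma formal_bracket_constant_deformation:
  "formal_bracket (constant_deformation m) = base_change fps_const m"
  unfolding formal_bracket_def base_change_def
  by (intro arg_cong[of _ _ bracket_of] ext)
    (simp add: fps_eq_iff constant_deformation_def structure_const_def)

lemma formal_bracket_constant_R20_0: "formal_bracket (constant_deformation R20_0) = nf_bracket 0"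
  by (simp add: formal_bracket_constant_deformation base_change_nf_bracket flip: nf_bracket_zero)

lemma structure_const_R20_0: "structure_const R20_0 = nf_consts 0"
  by (simp add: nf_bracket_def flip: nf_bracket_zero)

lemma formal_bracket_axis_coeff_0:
  assumes "\<phi> 0 = R20_0"
  shows "fps_nth (formal_bracket \<phi> (axis i 1) (axis j 1) $ k) 0 = nf_consts 0 i j k"
  by (simp add: formal_bracket_def bracket_of_axis_nth assms structure_const_R20_0)

lemma frame_det_formal_bracket_coeff_0:
  assumes "\<phi> 0 = R20_0"
  shows "fps_nth (frame_det (formal_bracket \<phi>)) 0 = 1"
  by (simp add: frame_det_def minor34_def formal_bracket_axis_coeff_0[of \<phi>, OF assms] nf_consts_def)

lemma bilinear_br_formal_bracket: "bilinear_br (formal_bracket \<phi>)"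
  unfolding formal_bracket_def by (rule bilinear_br_bracket_of)

text \<open>The spanning condition holds over C((t)) because the determinant of the frame is nonzero
  already at t = 0. The result then descends along the embedding of C[[t]].\<close>

lemma metric_generic_comm_nil:
  fixes \<phi> :: "nat \<Rightarrow> (complex, 4) bracket"
  assumes \<phi>0: "\<phi> 0 = R20_0" and met: "metric_leibniz (generic_bracket \<phi>)"
  shows "comm_nil (generic_bracket \<phi>)" "comm_nil (formal_bracket \<phi>)"
proof -
  interpret ring_map "fps_to_fls :: complex fps \<Rightarrow> complex fls" by (rule ring_map_to_fls)
  let ?m = "formal_bracket \<phi>" and ?g = "generic_bracket \<phi>"
  have g: "?g (axis i 1) (axis j 1) $ k = fps_to_fls (?m (axis i 1) (axis j 1) $ k)" for i j k
    by (simp add: generic_bracket_def base_change_def bracket_of_axis_nth structure_const_def)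
  let ?a = "\<lambda>m. m (axis 2 1) (axis 2 1)"
  let ?b = "\<lambda>m. m (axis 1 1) (axis 2 1) + m (axis 2 1) (axis 1 1)"
  \<comment> \<open>At t = 0, e2^2 = e3 and e1 e2 + e2 e1 = 2 e4.\<close>
  have "fps_nth (minor34 (?a ?m) (?b ?m)) 0 = 2"
    by (simp add: minor34_def formal_bracket_axis_coeff_0[of \<phi>, OF \<phi>0] nf_consts_def)
  then have "minor34 (?a ?m) (?b ?m) \<noteq> 0" by auto
  moreover have "minor34 (?a ?g) (?b ?g) = fps_to_fls (minor34 (?a ?m) (?b ?m))"
    by (simp add: minor34_def g map_diff map_mult map_add)
  ultimately have e: "minor34 (?a ?g) (?b ?g) * inverse (minor34 (?a ?g) (?b ?g)) = 1"
    by simp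
  have "\<exists>\<alpha> \<beta> \<gamma> \<delta>. x = \<alpha> *s axis 1 1 + \<beta> *s axis 2 1 + \<gamma> *s ?a ?g + \<delta> *s ?b ?g" for x
    using frame_expansion[OF e, of x] by blast
  then show cn: "comm_nil ?g"
    by (intro metric_leibniz_comm_nil[OF met, of "axis 1 1" "axis 2 1"]) simp_all
  show "comm_nil ?m"
    using comm_nil_base_change_inj cn unfolding generic_bracket_def formal_bracket_def
    by (simp add: inj_def)
qed

text \<open>The normal form is then that of D = 0, which is \<open>R20_0\<close> over C[[t]]. The
  frame determinant is a unit, having constant term 1, and \<open>nf_map\<close> is the identity
  modulo t, hence an equivalence.\<close>

lemma trivial_deformation_if_pencil_disc_eq_0:
  fixes \<phi> :: "nat \<Rightarrow> (complex, 4) bracket"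
  assumes \<phi>0: "\<phi> 0 = R20_0" and cn: "comm_nil (formal_bracket \<phi>)"
    and disc: "pencil_disc (formal_bracket \<phi>) = 0"
  shows "trivial_deformation R20_0 \<phi>"
proof -
  let ?m = "formal_bracket \<phi>"
  have d: "fps_nth (frame_det ?m) 0 = 1" by (rule frame_det_formal_bracket_coeff_0[of \<phi>, OF \<phi>0])
  define e where "e = inverse (frame_det ?m)"
  define half where "half = fps_const (1 / 2 :: complex)"
  have e: "frame_det ?m * e = 1"
    unfolding e_def by (rule inverse_mult_eq_1') (simp add: d)
  have "(2 :: complex fps) = fps_const 2"
    by (rule numeral_fps_const)
  then have half: "2 * half = 1"
    by (simp add: half_def)
  define s where "s = nf_shift e half ?m"
  define F where "F = nf_map s ?m"
  have F: "bij F" "F (nf_bracket 0 x y) = ?m (F x) (F y)" for x y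
    using nf_map_normal_form[OF bilinear_br_formal_bracket cn e half] disc
    unfolding F_def s_def by simp_all
  have F_lin: "F (x + y) = F x + F y" "F (c *s x) = c *s F x" for x y c
    by (simp_all add: F_def nf_map_def lin_comb4_linear)
  have s0: "fps_nth s 0 = 0"
    by (simp add: s_def nf_shift_def minor34_def formal_bracket_axis_coeff_0[of \<phi>, OF \<phi>0] nf_consts_def)
  define \<Phi> where "\<Phi> = (\<lambda>n (x :: complex ^ 4). \<chi> k. \<Sum>i\<in>UNIV. fps_nth (F (axis i 1) $ k) n * x $ i)"
  have \<Phi>: "formal_map \<Phi> = F" "Vector_Spaces.linear (*s) (*s) (\<Phi> n)" for n
    unfolding \<Phi>_def by (rule formal_map_coefficients[of F, OF F_lin])+
  have "fps_nth (F (axis i 1) $ k) 0 = (if i = k then 1 else 0)" for i k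
    using exhaust_4[of i] exhaust_4[of k]
    by (auto simp: F_def nf_map_def lin_comb4_def s0 formal_bracket_axis_coeff_0[of \<phi>, OF \<phi>0] nf_consts_def)
  then have "\<Phi> 0 = id"
    by (simp add: \<Phi>_def fun_eq_iff vec_eq_iff mult_delta_left)
  moreover have "?m x y = F (nf_bracket 0 (inv_into UNIV F x) (inv_into UNIV F y))" for x y
    using F by (simp add: bij_is_surj surj_f_inv_f)
  ultimately show ?thesis
    unfolding trivial_deformation_def equivalent_deformations_def formal_bracket_constant_R20_0
    using \<Phi> by (intro exI[of _ \<Phi>]) simp
qed

lemma metric_deformation_pencil_disc:
  assumes "metric_deformation R20_0 \<phi>"
  shows "\<phi> 0 = R20_0" "bilinear_bracket (\<phi> n)" "comm_nil (generic_bracket \<phi>)"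
    "comm_nil (formal_bracket \<phi>)" "pencil_disc (formal_bracket \<phi>) \<noteq> 0"
  using assms metric_generic_comm_nil trivial_deformation_if_pencil_disc_eq_0
  unfolding metric_deformation_def deformation_def by blast+

text \<open>The embeddings of C[[t]] into C((t)) and of C((t)) into its closure are injective, so
  frame determinant and discriminant stay nonzero.\<close>

lemma metric_deformation_formally_deforms_to:
  assumes "metric_deformation R20_0 \<phi>"
  shows "formally_deforms_to \<phi> (direct_sum mu1 mu1)"
proof -
  note def = metric_deformation_pencil_disc[OF assms]
  interpret fls: ring_map "fps_to_fls :: complex fps \<Rightarrow> complex fls" by (rule ring_map_to_fls)
  interpret ac: ring_map "to_ac :: complex fls \<Rightarrow> _" by (rule ring_map_to_ac)
  obtain c where c: "formal_bracket \<phi> = bracket_of c"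
    unfolding formal_bracket_def by blast
  define c' where "c' i j k = fps_to_fls (c i j k)" for i j k
  have c': "generic_bracket \<phi> = bracket_of c'"
    unfolding generic_bracket_def c base_change_bracket_of c'_def ..
  have c'_base: "bracket_of c' = base_change fps_to_fls (bracket_of c)"
    unfolding base_change_bracket_of c'_def ..
  have "frame_det (bracket_of c) \<noteq> 0"
    using frame_det_formal_bracket_coeff_0[of \<phi>, OF def(1)] c by auto
  then have "frame_det (bracket_of c') \<noteq> 0" "pencil_disc (bracket_of c') \<noteq> 0"
    using def(5) by (simp_all add: c'_base c fls.frame_det_base_change fls.pencil_disc_base_change)
  then show ?thesis
    unfolding formally_deforms_to_def c'
    by (intro comm_nil_isomorphic_direct_sum exists_square_root ac.comm_nil_base_change)
      (use def(3) in \<open>simp_all add: c' ac.frame_det_base_change ac.pencil_disc_base_change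
        bilinear_br_base_change\<close>)
qed

section \<open>Polynomial deformations and specialization\<close>

text \<open>A single bracket over C[t] governs both sides, so identities and nonvanishing travel
  from power series through C[t] to complex values of t.\<close>

lemma polynomial_deformation_lift:
  fixes \<phi> :: "nat \<Rightarrow> (complex, 'n::finite) bracket"
  assumes pol: "polynomial_deformation \<phi>" and bil: "\<And>n. bilinear_bracket (\<phi> n)"
  obtains p where "formal_bracket \<phi> = base_change fps_of_poly (bracket_of p)"
    and "\<And>t. specialize \<phi> t = base_change (\<lambda>q. poly q t) (bracket_of p)"
proof
  define S where "S = {n. \<phi> n \<noteq> (\<lambda>x y. 0)}"
  have S: "finite S" using pol by (simp add: polynomial_deformation_def S_def)
  define p where "p i j k = (\<Sum>n\<in>S. Polynomial.monom (structure_const (\<phi> n) i j k) n)" for i j k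
  show "formal_bracket \<phi> = base_change fps_of_poly (bracket_of p)"
    unfolding formal_bracket_def base_change_bracket_of
  proof (intro arg_cong[of _ _ bracket_of] ext fps_ext)
    fix i j k n
    have "Polynomial.coeff (p i j k) n = (if n \<in> S then structure_const (\<phi> n) i j k else 0)"
      using S by (simp add: p_def coeff_sum)
    also have "\<dots> = structure_const (\<phi> n) i j k"
      by (auto simp: S_def structure_const_def)
    finally show "fps_nth (Abs_fps (\<lambda>n. structure_const (\<phi> n) i j k)) n
      = fps_nth (fps_of_poly (p i j k)) n" by simp
  qed
  show "specialize \<phi> t = base_change (\<lambda>q. poly q t) (bracket_of p)" for t
  proof (intro ext)
    fix x y
    have br: "\<phi> n x y $ k = (\<Sum>i\<in>UNIV. \<Sum>j\<in>UNIV. structure_const (\<phi> n) i j k * x $ i * y $ j)" for n k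
    proof -
      have "bracket_of (structure_const (\<phi> n)) = \<phi> n"
        by (rule bilinear_br.bracket_of_structure_const) (simp add: bilinear_br_def bil)
      then have "\<phi> n x y $ k = bracket_of (structure_const (\<phi> n)) x y $ k" by simp
      then show ?thesis by (simp only: bracket_of_nth)
    qed
    have "(\<Sum>n\<in>S. t ^ n * \<phi> n x y $ k)
        = (\<Sum>i\<in>UNIV. \<Sum>j\<in>UNIV. poly (p i j k) t * x $ i * y $ j)" for k
    proof -
      have "(\<Sum>n\<in>S. t ^ n * \<phi> n x y $ k)
          = (\<Sum>n\<in>S. \<Sum>i\<in>UNIV. \<Sum>j\<in>UNIV. structure_const (\<phi> n) i j k * t ^ n * x $ i * y $ j)"
        by (simp only: br sum_distrib_left mult_ac)
      also have "\<dots> = (\<Sum>i\<in>UNIV. \<Sum>n\<in>S. \<Sum>j\<in>UNIV. structure_const (\<phi> n) i j k * t ^ n * x $ i * y $ j)"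
        by (rule sum.swap)
      also have "\<dots> = (\<Sum>i\<in>UNIV. \<Sum>j\<in>UNIV. \<Sum>n\<in>S. structure_const (\<phi> n) i j k * t ^ n * x $ i * y $ j)"
        by (intro sum.cong refl sum.swap)
      also have "\<dots> = (\<Sum>i\<in>UNIV. \<Sum>j\<in>UNIV. poly (p i j k) t * x $ i * y $ j)"
        by (simp only: p_def poly_sum poly_monom sum_distrib_right)
      finally show ?thesis .
    qed
    then show "specialize \<phi> t x y = base_change (\<lambda>q. poly q t) (bracket_of p) x y"
      by (simp add: specialize_def base_change_bracket_of vec_eq_iff bracket_of_nth flip: S_def)
  qed
qed

lemma eventually_poly_neq_0:
  fixes p :: "complex poly"
  assumes "p \<noteq> 0"
  shows "\<forall>\<^sub>F t in at a. poly p t \<noteq> 0"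
proof -
  have "finite {t. poly p t = 0}" using assms by (rule poly_roots_finite)
  \<comment> \<open>The point a may itself be a root, as 0 is for the discriminant, so only the
    other roots are removed.\<close>
  then have "open (- ({t. poly p t = 0} - {a}))"
    by (intro open_Compl finite_imp_closed) simp
  then show ?thesis
    unfolding eventually_at_topological by fastforce
qed

text \<open>The identities descend to C[t], since \<open>fps_of_poly\<close> is injective, and then
  hold at every t. Frame determinant and discriminant are nonzero polynomials, so only finitely many
  t are lost.\<close>

lemma metric_deformation_deforms_to:
  assumes met: "metric_deformation R20_0 \<phi>" and pol: "polynomial_deformation \<phi>"
  shows "deforms_to \<phi> (direct_sum mu1 mu1)"
proof -
  note def = metric_deformation_pencil_disc[OF met]
  from polynomial_deformation_lift[OF pol def(2)] obtain p
    where formal: "formal_bracket \<phi> = base_change fps_of_poly (bracket_of p)"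
      and special: "\<And>t. specialize \<phi> t = base_change (\<lambda>q. poly q t) (bracket_of p)"
    by blast
  interpret fps: ring_map "fps_of_poly :: complex poly \<Rightarrow> _" by (rule ring_map_fps_of_poly)
  have cn: "comm_nil (bracket_of p)"
    using fps.comm_nil_base_change_inj def(4) formal by (simp add: inj_def fps_of_poly_eq_iff)
  have "fps_of_poly (frame_det (bracket_of p)) \<noteq> 0"
    using frame_det_formal_bracket_coeff_0[of \<phi>, OF def(1)] fps.frame_det_base_change[of p]
    unfolding formal by auto
  moreover have "fps_of_poly (pencil_disc (bracket_of p)) \<noteq> 0"
    using def(5) fps.pencil_disc_base_change[of p] unfolding formal by simp
  ultimately have "frame_det (bracket_of p) * pencil_disc (bracket_of p) \<noteq> 0"
    by auto
  then have "\<forall>\<^sub>F t in at 0. poly (frame_det (bracket_of p) * pencil_disc (bracket_of p)) t \<noteq> 0"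
    by (rule eventually_poly_neq_0)
  moreover have "alg_isomorphic (specialize \<phi> t) (direct_sum mu1 mu1)"
    if nz: "poly (frame_det (bracket_of p) * pencil_disc (bracket_of p)) t \<noteq> 0" for t
  proof -
    interpret ev: ring_map "\<lambda>q :: complex poly. poly q t" by (rule ring_map_poly)
    have "alg_isomorphic (specialize \<phi> t) (base_change (\<lambda>z. z) (direct_sum mu1 mu1))"
      unfolding special
      by (intro comm_nil_isomorphic_direct_sum exists_square_root ev.comm_nil_base_change cn)
        (use nz in \<open>simp_all add: ev.frame_det_base_change ev.pencil_disc_base_change
          bilinear_br_base_change\<close>)
    then show ?thesis by (simp add: direct_sum_mu1_eq base_change_bracket_of)
  qed
  ultimately show ?thesis
    unfolding deforms_to_def using pol by (auto elim: eventually_mono)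
qed

section \<open>An explicit metric deformation\<close>

text \<open>The normal form with D = t, the simplest nonzero discriminant vanishing at t =
  0.\<close>

definition square_deformation :: "nat \<Rightarrow> (complex, 4) bracket" where
  "square_deformation n =
     (if n = 0 then R20_0
      else if n = 1 then bracket_of (\<lambda>i j k. if (i, j, k) = (1, 1, 3) then 1 else 0)
      else (\<lambda>x y. 0))"

lemma formal_bracket_square_deformation: "formal_bracket square_deformation = nf_bracket fps_X"
  unfolding formal_bracket_def nf_bracket_def
  by (intro arg_cong[of _ _ bracket_of] ext fps_ext)
    (simp add: square_deformation_def structure_const_R20_0, simp add: structure_const_def nf_consts_def fps_X_def)

text \<open>Triviality would transport \<open>e\<^sub>1\<close> with \<open>[e\<^sub>1, e\<^sub>1] = 0\<close> to a vector \<open>v\<close> congruent to \<open>e\<^sub>1\<close> modulo \<open>t\<close>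
  with \<open>[v, v] = 0\<close> in the deformed algebra.\<close>

lemma square_deformation_nontrivial: "\<not> trivial_deformation R20_0 square_deformation"
proof
  assume "trivial_deformation R20_0 square_deformation"
  then obtain \<Phi> where \<Phi>0: "\<Phi> 0 = id"
    and eq: "\<And>x y. nf_bracket fps_X x y = formal_map \<Phi>
      (nf_bracket 0 (inv_into UNIV (formal_map \<Phi>) x) (inv_into UNIV (formal_map \<Phi>) y))"
    unfolding trivial_deformation_def equivalent_deformations_def
      formal_bracket_constant_R20_0 formal_bracket_square_deformation by blast
  define v where "v = formal_map \<Phi> (axis 1 1)"
  have "inv_into UNIV (formal_map \<Phi>) v = axis 1 1"
    unfolding v_def by (rule inv_f_f[OF inj_formal_map[of \<Phi>, OF \<Phi>0]])
  moreover have "nf_bracket 0 (axis 1 1) (axis 1 1) = (0 :: complex fps ^ 4)"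
    by (simp add: vec_eq_iff forall_4 nf_bracket_nth)
  ultimately have "nf_bracket fps_X v v = 0"
    by (simp add: eq formal_map_zero)
  then have v3: "fps_X * v$1 * v$1 + v$2 * v$2 = 0" and v4: "v$1 * v$2 + v$2 * v$1 = 0"
    by (simp_all add: vec_eq_iff forall_4 nf_bracket_nth)
  have "fps_nth (v$1) 0 = 1"
    by (simp add: v_def formal_map_def \<Phi>0 sum_4)
  then have "v$1 \<noteq> 0" by auto
  \<comment> \<open>From 2 v1 v2 = 0 follows v2 = 0, and then t v1^2 = 0 contradicts v1 being
    nonzero.\<close>
  with v3 v4 show False by auto
qed

lemma square_deformation_metric: "metric_deformation R20_0 square_deformation"
proof -
  have "bilinear_bracket (square_deformation n)" for n
    unfolding square_deformation_def R20_0_def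
    by (simp add: bilinear_br.bilinear[OF bilinear_br_bracket_of])
      (simp add: bilinear_bracket_iff)
  moreover have "square_deformation 0 = R20_0" by (simp add: square_deformation_def)
  moreover have "generic_bracket square_deformation = nf_bracket (fps_to_fls fps_X)"
    by (simp add: generic_bracket_def formal_bracket_square_deformation base_change_nf_bracket)
  ultimately show ?thesis
    unfolding metric_deformation_def deformation_def
    using square_deformation_nontrivial
    by (simp add: metric_leibniz_nf_bracket formal_bracket_square_deformation
        leibniz_bracket_comm_nil bilinear_br_nf_bracket comm_nil_nf_bracket)
qed

lemma square_deformation_polynomial: "polynomial_deformation square_deformation"
proof -
  have "{n. square_deformation n \<noteq> (\<lambda>x y. 0)} \<subseteq> {0, 1}"
    by (auto simp: square_deformation_def split: if_splits)
  then show ?thesis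
    unfolding polynomial_deformation_def by (rule finite_subset) simp
qed

text \<open>Counting by isomorphism type becomes three claims: the type occurs, and no other type
  does, in the formal sense and by specialization.\<close>

theorem theorem4p3:
  shows "(\<exists>\<phi>. metric_deformation R20_0 \<phi> \<and> deforms_to \<phi> (direct_sum mu1 mu1)) \<and>
    (\<forall>\<phi>. metric_deformation R20_0 \<phi> \<longrightarrow> formally_deforms_to \<phi> (direct_sum mu1 mu1)) \<and>
    (\<forall>\<phi>. metric_deformation R20_0 \<phi> \<and> polynomial_deformation \<phi>
        \<longrightarrow> deforms_to \<phi> (direct_sum mu1 mu1))"
  using square_deformation_metric square_deformation_polynomial
    metric_deformation_formally_deforms_to metric_deformation_deforms_to by blast

end
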